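(* Suppose that one of the following holds: (i) $(X,K)$ is a pre-Riesz space with a regular norm $\|\cdot\|$ such that $K$ is closed; or (ii) $(X,K,\|\cdot\|)$ is an ordered Banach space with a semimonotone norm. Then every band in $X$ is closed (with respect to $\|\cdot\|$).
   Context: All vector spaces are real. A cone $K$ in $X$ is a subset with $\lambda x+\mu y\in K$ for all $x,y\in K$, $\lambda,\mu\ge 0$, and $K\cap(-K)=\{0\}$; it induces the partial order $x\le y:\Leftrightarrow y-x\in K$. $K$ is generating (equivalently $(X,K)$ is directed) if $X=K-K$. For $S\subseteq X$, $S^{\mathrm{u}}=\{x\in X: x\ge s\text{ for all }s\in S\}$. $(X,K)$ is a pre-Riesz space if for all $x,y,z\in X$ the inclusion $\{x+y,x+z\}^{\mathrm{u}}\subseteq\{y,z\}^{\mathrm{u}}$ implies $x\in K$; every pre-Riesz space is directed, and every directed Archimedean partially ordered vector space is pre-Riesz. A norm on a directed $X$ is regular if $\|x\|=\inf\{\|y\|: y\in X,\ -y\le x\le y\}$ for every $x\in X$. A norm is semimonotone if there is a constant $M\in\mathbb{R}$ such that $0\le x\le y$ implies $\|x\|\le M\|y\|$. An ordered Banach space is a Banach space with a closed generating cone. Elements $x,y\in X$ are disjoint, $x\perp y$, if $\{x+y,-x-y\}^{\mathrm{u}}=\{x-y,-x+y\}^{\mathrm{u}}$. The disjoint complement of $S\subseteq X$ is $S^{\mathrm{d}}=\{y\in X: y\perp x\text{ for all }x\in S\}$, and $S^{\mathrm{dd}}=(S^{\mathrm{d}})^{\mathrm{d}}$. A linear subspace $B\subseteq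 X$ is a band if $B=B^{\mathrm{dd}}$. *)

theory Defs
  imports "HOL-Analysis.Analysis"
begin

text \<open>
  The space \<open>X\<close> is the whole carrier type, and the order is given by an explicit cone \<open>K\<close>
  rather than by a type class instance.
\<close>

definition order_cone :: "'a::real_vector set \<Rightarrow> bool" where
  "order_cone K \<longleftrightarrow>
     (\<forall>x\<in>K. \<forall>y\<in>K. \<forall>l\<ge>0. \<forall>m\<ge>0. l *\<^sub>R x + m *\<^sub>R y \<in> K) \<and> K \<inter> uminus ` K = {0}"

definition cone_le :: "'a::real_vector set \<Rightarrow> 'a \<Rightarrow> 'a \<Rightarrow> bool" where
  "cone_le K x y \<longleftrightarrow> y - x \<in> K"

definition generating :: "'a::real_vector set \<Rightarrow> bool" where
  "generating K \<longleftrightarrow> UNIV = {x - y | x y. x \<in> K \<and> y \<in> K}"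

definition upper_bounds :: "'a::real_vector set \<Rightarrow> 'a set \<Rightarrow> 'a set" where
  "upper_bounds K S = {x. \<forall>s\<in>S. cone_le K s x}"

text \<open>Directedness is not assumed: it follows from the implication, using that the upper bound
  sets may be empty.\<close>

definition pre_Riesz :: "'a::real_vector set \<Rightarrow> bool" where
  "pre_Riesz K \<longleftrightarrow> order_cone K \<and>
     (\<forall>x y z. upper_bounds K {x + y, x + z} \<subseteq> upper_bounds K {y, z} \<longrightarrow> x \<in> K)"

text \<open>Requiring \<open>generating K\<close> makes each infimum range over a nonempty set.\<close>

definition regular_norm :: "'a::real_normed_vector set \<Rightarrow> bool" where
  "regular_norm K \<longleftrightarrow> generating K \<and>
     (\<forall>x. norm x = Inf {norm y | y. cone_le K (- y) x \<and> cone_le K x y})"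

definition semimonotone_norm :: "'a::real_normed_vector set \<Rightarrow> bool" where
  "semimonotone_norm K \<longleftrightarrow>
     (\<exists>M. \<forall>x y. cone_le K 0 x \<and> cone_le K x y \<longrightarrow> norm x \<le> M * norm y)"

definition ordered_Banach :: "'a::real_normed_vector set \<Rightarrow> bool" where
  "ordered_Banach K \<longleftrightarrow>
     complete (UNIV :: 'a set) \<and> order_cone K \<and> closed K \<and> generating K"

definition disjoint_elts :: "'a::real_vector set \<Rightarrow> 'a \<Rightarrow> 'a \<Rightarrow> bool" where
  "disjoint_elts K x y \<longleftrightarrow>
     upper_bounds K {x + y, - x - y} = upper_bounds K {x - y, - x + y}"

definition disj_compl :: "'a::real_vector set \<Rightarrow> 'a set \<Rightarrow> 'a set" where
  "disj_compl K S = {y. \<forall>x\<in>S. disjoint_elts K y x}"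

definition band :: "'a::real_vector set \<Rightarrow> 'a set \<Rightarrow> bool" where
  "band K B \<longleftrightarrow> subspace B \<and> B = disj_compl K (disj_compl K B)"

end

theory Submission
  imports Defs
begin

text \<open>
  In both cases a vector \<open>z\<close> of small norm lies in an order interval \<open>[-w, w]\<close> with \<open>w\<close> of small
  norm: for a regular norm this is immediate, and for an ordered Banach space it is the
  Krein--Smulian theorem (Baire category plus successive approximation). Hence if \<open>y'\<close> is close to
  \<open>y\<close>, each upper bound \<open>u\<close> of \<open>{y + x, -y - x}\<close> becomes an upper bound of \<open>{y' + x, -y' - x}\<close> after
  adding a small \<open>w\<close>; if \<open>y' \<bottom> x\<close>, then \<open>u + 2w\<close> is an upper bound of \<open>{y - x, -y + x}\<close>. As \<open>w\<close>
  tends to \<open>0\<close> and \<open>K\<close> is closed, \<open>u\<close> is one as well. Thus disjoint complements are closed, and a band is one.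
\<close>

lemma order_cone_add: "order_cone K \<Longrightarrow> x \<in> K \<Longrightarrow> y \<in> K \<Longrightarrow> x + y \<in> K"
  unfolding order_cone_def by (metis scaleR_one zero_le_one)

lemma order_cone_scaleR: "order_cone K \<Longrightarrow> x \<in> K \<Longrightarrow> 0 \<le> c \<Longrightarrow> c *\<^sub>R x \<in> K"
  unfolding order_cone_def by (metis add.right_neutral order.refl scaleR_zero_left)

lemma order_cone_zero: "order_cone K \<Longrightarrow> 0 \<in> K"
  unfolding order_cone_def by blast

lemma order_cone_sum:
  "order_cone K \<Longrightarrow> (\<And>i. i \<in> I \<Longrightarrow> f i \<in> K) \<Longrightarrow> sum f I \<in> K"
  by (induction I rule: infinite_finite_induct) (auto intro: order_cone_zero order_cone_add)

text \<open>The interface between the two cases: each hypothesis of the theorem implies it, and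
  together with closedness of \<open>K\<close> it suffices for disjoint complements to be
  closed.\<close>

definition norm_order_dominated :: "'a::real_normed_vector set \<Rightarrow> bool" where
  "norm_order_dominated K \<longleftrightarrow>
     (\<forall>e>0. \<exists>d>0. \<forall>z. norm z < d \<longrightarrow> (\<exists>w. norm w < e \<and> cone_le K (- w) z \<and> cone_le K z w))"

section \<open>Closedness of disjoint complements\<close>

lemma closed_upper_bounds:
  fixes K :: "'a::real_normed_vector set"
  assumes "closed K"
  shows "closed (upper_bounds K S)"
proof -
  have "upper_bounds K S = (\<Inter>s\<in>S. (\<lambda>x. x - s) -` K)"
    by (auto simp: upper_bounds_def cone_le_def)
  then show ?thesis
    using assms by (auto intro!: closed_INT continuous_closed_vimage continuous_intros)
qed

lemma upper_bounds_subset_closure: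
  fixes K :: "'a::real_normed_vector set"
  assumes K: "closed K" "order_cone K" "norm_order_dominated K"
    and y: "y \<in> closure {y. disjoint_elts K y x}"
  shows "upper_bounds K {y + x, - y - x} \<subseteq> upper_bounds K {y - x, - y + x}"
proof
  fix u assume u: "u \<in> upper_bounds K {y + x, - y - x}"
  have "\<exists>v\<in>upper_bounds K {y - x, - y + x}. dist v u < e" if "e > 0" for e
  proof -
    \<comment> \<open>The bound is \<open>e/2\<close> because \<open>w\<close> is added twice: once
      to pass from \<open>y\<close> to \<open>y'\<close>, and once to return from \<open>y'\<close>
      to \<open>y\<close> after disjointness has been used.\<close>
    from that K(3) obtain d where d: "d > 0"
      "\<And>z. norm z < d \<Longrightarrow> \<exists>w. norm w < e/2 \<and> cone_le K (- w) z \<and> cone_le K z w"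
      unfolding norm_order_dominated_def by (meson half_gt_zero)
    from y d(1) obtain y' where y': "disjoint_elts K y' x" "norm (y' - y) < d"
      unfolding closure_approachable dist_norm by blast
    from d(2)[OF y'(2)] obtain w where
      w: "norm w < e/2" "(y' - y) + w \<in> K" "w - (y' - y) \<in> K"
      by (auto simp: cone_le_def)
    have uK: "u - (y + x) \<in> K" "u + (y + x) \<in> K"
      using u by (auto simp: upper_bounds_def cone_le_def algebra_simps)
    have "(u + w) - (y' + x) \<in> K" "(u + w) + (y' + x) \<in> K"
      using order_cone_add[OF K(2) uK(1) w(3)] order_cone_add[OF K(2) uK(2) w(2)]
      by (simp_all add: algebra_simps)
    then have "u + w \<in> upper_bounds K {y' + x, - y' - x}"
      by (simp add: upper_bounds_def cone_le_def algebra_simps)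
    then have "u + w \<in> upper_bounds K {y' - x, - y' + x}"
      using y'(1) by (simp add: disjoint_elts_def)
    then have *: "(u + w) - (y' - x) \<in> K" "(u + w) + (y' - x) \<in> K"
      by (simp_all add: upper_bounds_def cone_le_def algebra_simps)
    have "(u + 2 *\<^sub>R w) - (y - x) \<in> K" "(u + 2 *\<^sub>R w) + (y - x) \<in> K"
      using order_cone_add[OF K(2) *(1) w(2)] order_cone_add[OF K(2) *(2) w(3)]
      by (simp_all add: algebra_simps scaleR_2)
    then have "u + 2 *\<^sub>R w \<in> upper_bounds K {y - x, - y + x}"
      by (simp add: upper_bounds_def cone_le_def algebra_simps)
    moreover have "dist (u + 2 *\<^sub>R w) u < e"
      using w(1) by (simp add: dist_norm)
    ultimately show ?thesis by blast
  qed
  then have "u \<in> closure (upper_bounds K {y - x, - y + x})"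
    by (simp add: closure_approachable)
  then show "u \<in> upper_bounds K {y - x, - y + x}"
    using closed_upper_bounds[OF K(1)] by (metis closure_closed)
qed

text \<open>Changing the sign of \<open>x\<close> swaps the two sets of upper bounds. Hence the
  inclusion already proved for points of the closure also yields the reverse inclusion.\<close>

lemma disjoint_elts_minus: "disjoint_elts K y (- x) \<longleftrightarrow> disjoint_elts K y x"
  by (auto simp: disjoint_elts_def)

lemma closed_disj_compl:
  fixes K :: "'a::real_normed_vector set"
  assumes K: "closed K" "order_cone K" "norm_order_dominated K"
  shows "closed (disj_compl K S)"
proof -
  have "closed {y. disjoint_elts K y x}" for x
  proof -
    have "disjoint_elts K y x" if "y \<in> closure {y. disjoint_elts K y x}" for y
      unfolding disjoint_elts_def
    proof
      have "y \<in> closure {y. disjoint_elts K y (- x)}"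
        using that by (simp add: disjoint_elts_minus)
      from upper_bounds_subset_closure[OF K this]
      show "upper_bounds K {y - x, - y + x} \<subseteq> upper_bounds K {y + x, - y - x}"
        by simp
    qed (rule upper_bounds_subset_closure[OF K that])
    then show ?thesis
      by (metis closure_subset_eq mem_Collect_eq subsetI)
  qed
  moreover have "disj_compl K S = (\<Inter>x\<in>S. {y. disjoint_elts K y x})"
    by (auto simp: disj_compl_def)
  ultimately show ?thesis by auto
qed

section \<open>Small dominating vectors from a regular norm\<close>

lemma norm_order_dominated_regular:
  assumes K: "order_cone K" and reg: "regular_norm K"
  shows "norm_order_dominated K"
proof -
  have "\<exists>w. norm w < e \<and> cone_le K (- w) z \<and> cone_le K z w" if "norm z < e" for e z
  proof -
    let ?N = "{norm w | w. cone_le K (- w) z \<and> cone_le K z w}"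
    obtain a b where ab: "z = a - b" "a \<in> K" "b \<in> K"
      using reg unfolding regular_norm_def generating_def by blast
    \<comment> \<open>This witness makes the set under the infimum nonempty, so an infimum below
      \<open>e\<close> provides a member below \<open>e\<close>.\<close>
    have "cone_le K (- (a + b)) z" "cone_le K z (a + b)"
      using order_cone_add[OF K ab(2) ab(2)] order_cone_add[OF K ab(3) ab(3)]
      unfolding ab(1) by (simp_all add: cone_le_def)
    then have ne: "?N \<noteq> {}" by blast
    have "Inf ?N < e"
      using reg that unfolding regular_norm_def by metis
    then show ?thesis
      using cInf_lessD[OF ne] by blast
  qed
  then show ?thesis
    unfolding norm_order_dominated_def by blast
qed

section \<open>Krein--Smulian decomposition in ordered Banach spaces\<close>

lemma summable_norm_cancel_complete:
  fixes f :: "nat \<Rightarrow> 'a::real_normed_vector"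
  assumes "complete (UNIV :: 'a set)" and f: "summable (\<lambda>n. norm (f n))"
  shows "summable f"
proof -
  \<comment> \<open>Completeness is a hypothesis on the carrier and not the class
    \<open>banach\<close>, so convergence is obtained from the Cauchy property of the partial
    sums.\<close>
  have "Cauchy (\<lambda>n. sum f {..<n})"
  proof (rule CauchyI')
    fix e :: real assume "0 < e"
    then obtain N where N: "\<And>m n. m \<ge> N \<Longrightarrow> norm (\<Sum>k=m..<n. norm (f k)) < e"
      using f unfolding summable_Cauchy by blast
    have "norm (sum f {..<m} - sum f {..<n}) < e" if "m \<ge> N" "m < n" for m n
    proof -
      have "norm (sum f {..<m} - sum f {..<n}) = norm (sum f {m..<n})"
        using that(2) sum_diff_nat_ivl[of 0 m n f]
        by (subst norm_minus_commute) (simp add: atLeast0LessThan)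
      also have "\<dots> \<le> (\<Sum>k=m..<n. norm (f k))" by (rule norm_sum)
      also have "\<dots> < e" using N[OF that(1), of n] by simp
      finally show ?thesis .
    qed
    then show "\<exists>M. \<forall>m\<ge>M. \<forall>n>m. dist (sum f {..<m}) (sum f {..<n}) < e"
      unfolding dist_norm by blast
  qed
  then show ?thesis
    using assms(1) unfolding complete_def summable_def sums_def by blast
qed

lemma convex_order_cone:
  assumes "order_cone K"
  shows "convex K"
  using assms unfolding order_cone_def convex_def by simp

text \<open>The differences of cone elements of norm at most \<open>n\<close> form convex symmetric
  sets \<open>D n\<close> that cover the space. By Baire, some \<open>closure (D n)\<close> contains
  a ball; convexity and symmetry move the ball to the origin, and scaling does the rest. Since only
  the closure is controlled, the decomposition is approximate.\<close>

lemma generating_approx: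
  fixes K :: "'a::real_normed_vector set"
  assumes compl: "complete (UNIV :: 'a set)" and K: "order_cone K" and gen: "generating K"
  obtains r where "r > 0"
    "\<And>z t d. t > 0 \<Longrightarrow> d > 0 \<Longrightarrow> norm z < r * t \<Longrightarrow>
       \<exists>a\<in>K. \<exists>b\<in>K. norm a \<le> t \<and> norm b \<le> t \<and> norm (z - (a - b)) < d"
proof -
  \<comment> \<open>The nested union is the form to which \<open>convex_differences\<close>
    applies.\<close>
  define D where "D n = (\<Union>a\<in>K \<inter> cball 0 (real n). \<Union>b\<in>K \<inter> cball 0 (real n). {a - b})" for n
  have D_iff: "z \<in> D n \<longleftrightarrow>
      (\<exists>a\<in>K. \<exists>b\<in>K. norm a \<le> real n \<and> norm b \<le> real n \<and> z = a - b)" for z n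
    unfolding D_def UN_iff singleton_iff Bex_def Int_iff mem_cball_0 by blast
  have convex_D: "convex (D n)" for n
    unfolding D_def
    by (intro convex_differences convex_Int convex_order_cone[OF K] convex_cball)
  have "\<exists>n. z \<in> D n" for z
  proof -
    obtain a b where ab: "z = a - b" "a \<in> K" "b \<in> K"
      using gen unfolding generating_def by blast
    obtain n where "max (norm a) (norm b) \<le> real n" using real_arch_simple by blast
    with ab show ?thesis unfolding D_iff by (metis max.bounded_iff)
  qed
  then have "(\<Union>n. closure (D n)) = UNIV" using closure_subset by blast
  then have "\<exists>n. interior (closure (D n)) \<noteq> {}"
    using Met_TC.metric_Baire_category_alt[where 'a='a, of "range (\<lambda>n. closure (D n))"] compl
    by auto
  then obtain n c \<rho> where c: "\<rho> > 0" "ball c \<rho> \<subseteq> closure (D n)"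
    by (metis equals0I mem_interior)
  have sym: "- z \<in> closure (D n)" if "z \<in> closure (D n)" for z
  proof -
    have "uminus ` D n \<subseteq> D n"
      unfolding image_subset_iff Ball_def D_iff by (metis minus_diff_eq)
    then have "uminus ` closure (D n) \<subseteq> closure (D n)"
      using closure_subset by (intro image_closure_subset continuous_intros closed_closure) blast
    with that show ?thesis by blast
  qed
  have ball: "z \<in> closure (D n)" if "norm z < \<rho>" for z
  proof -
    \<comment> \<open>The point \<open>z\<close> is the midpoint of \<open>c + z\<close> and
      \<open>-(c - z)\<close>.\<close>
    have "c + z \<in> closure (D n)" "c - z \<in> closure (D n)"
      using c(2) that by (auto simp: subset_iff dist_norm)
    then have "c + z \<in> closure (D n)" "z - c \<in> closure (D n)"
      using sym[of "c - z"] by simp_all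
    then have "(1/2) *\<^sub>R (c + z) + (1/2) *\<^sub>R (z - c) \<in> closure (D n)"
      by (intro convexD[OF convex_closure[OF convex_D]]) auto
    moreover have "(1/2) *\<^sub>R (c + z) + (1/2) *\<^sub>R (z - c) = z"
      by (simp add: scaleR_add_right[symmetric] scaleR_2[symmetric])
    ultimately show ?thesis by simp
  qed
  \<comment> \<open>Adding 1 allows division by \<open>m\<close> even if
    \<open>n = 0\<close>.\<close>
  define m where "m = real n + 1"
  have m: "m > 0" by (simp add: m_def)
  show thesis
  proof
    show "\<rho> / m > 0" using c(1) m by simp
    fix z :: 'a and t d :: real
    assume t: "t > 0" and d: "d > 0" and z: "norm z < \<rho> / m * t"
    \<comment> \<open>Enlarge \<open>z\<close> by \<open>m / t\<close>, approximate in
      \<open>D n\<close>, and shrink back: the norm bound \<open>n\<close> becomes at most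
      \<open>t\<close>, and the tolerance \<open>d * m / t\<close> becomes \<open>d\<close>.\<close>
    have "norm ((m / t) *\<^sub>R z) < \<rho>" using z t m by (simp add: field_simps)
    from ball[OF this] obtain v where "v \<in> D n" "dist v ((m / t) *\<^sub>R z) < d * m / t"
      unfolding closure_approachable using d m t by (meson divide_pos_pos mult_pos_pos)
    then obtain a b where ab: "a \<in> K" "b \<in> K" "norm a \<le> n" "norm b \<le> n"
      and less: "norm ((m / t) *\<^sub>R z - (a - b)) < d * m / t"
      by (auto simp: D_iff dist_norm norm_minus_commute)
    have "norm (z - ((t / m) *\<^sub>R a - (t / m) *\<^sub>R b)) = norm ((t / m) *\<^sub>R ((m / t) *\<^sub>R z - (a - b)))"
      using t m by (simp add: scaleR_diff_right)
    also have "\<dots> = t / m * norm ((m / t) *\<^sub>R z - (a - b))" using t m by simp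
    also have "\<dots> < d" using less t m by (simp add: field_simps)
    finally have "norm (z - ((t / m) *\<^sub>R a - (t / m) *\<^sub>R b)) < d" .
    moreover have "norm ((t / m) *\<^sub>R a) \<le> t" "norm ((t / m) *\<^sub>R b) \<le> t"
      using mult_left_mono[of "norm a" m t] mult_left_mono[of "norm b" m t] ab(3,4) t m
      by (simp_all add: pos_divide_le_eq m_def)
    moreover have "(t / m) *\<^sub>R a \<in> K" "(t / m) *\<^sub>R b \<in> K"
      using ab t m by (auto intro!: order_cone_scaleR[OF K])
    ultimately show "\<exists>a\<in>K. \<exists>b\<in>K. norm a \<le> t \<and> norm b \<le> t \<and> norm (z - (a - b)) < d"
      by blast
  qed
qed

text \<open>Completeness gives the limit, closedness keeps it in the cone, and the factor 2 is the
  sum of the geometric series with ratio 1/2.\<close>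

lemma cone_suminf_geometric:
  fixes K :: "'a::real_normed_vector set"
  assumes compl: "complete (UNIV :: 'a set)" and K: "order_cone K" "closed K"
    and a: "\<And>n. a n \<in> K" "\<And>n. norm (a n) \<le> t * (1/2)^n"
  obtains s where "a sums s" "s \<in> K" "norm s \<le> 2 * t"
proof -
  have geo: "(\<lambda>n. t * (1/2)^n) sums (t * 2)"
    using sums_mult[OF geometric_sums[of "1/2::real"], of t] by simp
  have "summable (\<lambda>n. norm (a n))"
    by (rule summable_comparison_test'[OF sums_summable[OF geo]]) (use a(2) in simp)
  then obtain s where s: "a sums s"
    using summable_norm_cancel_complete[OF compl] by (meson summable_def)
  then have lim: "(\<lambda>n. sum a {..<n}) \<longlonglongrightarrow> s" by (simp add: sums_def)
  have "s \<in> K"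
    by (rule closed_sequentially[OF K(2) _ lim]) (rule order_cone_sum[OF K(1) a(1)])
  moreover have "norm s \<le> 2 * t"
  proof (rule LIMSEQ_le_const2[OF tendsto_norm[OF lim]], intro exI allI impI)
    have t: "0 \<le> t" using order.trans[OF norm_ge_zero a(2)[of 0]] by simp
    fix n
    have "norm (sum a {..<n}) \<le> (\<Sum>k<n. t * (1/2)^k)"
      using a(2) by (intro sum_norm_le) auto
    also have "\<dots> \<le> t * 2"
      using t sum_le_suminf[OF sums_summable[OF geo], of "{..<n}"] sums_unique[OF geo] by simp
    finally show "norm (sum a {..<n}) \<le> 2 * t" by simp
  qed
  ultimately show thesis using that s by blast
qed

text \<open>Successive approximation removes the error: the remainder at stage \<open>n\<close> is
  below \<open>r * t / 2^n\<close>, so it can be decomposed approximately with parts of norm at most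
  \<open>t / 2^n\<close>, and the tolerance is chosen to halve the bound for the next remainder.
  Summing the parts gives an exact decomposition.\<close>

lemma ordered_Banach_decomposition:
  fixes K :: "'a::real_normed_vector set"
  assumes "ordered_Banach K"
  obtains r where "r > 0"
    "\<And>z t. t > 0 \<Longrightarrow> norm z < r * t \<Longrightarrow>
       \<exists>a\<in>K. \<exists>b\<in>K. norm a \<le> 2 * t \<and> norm b \<le> 2 * t \<and> z = a - b"
proof -
  have B: "complete (UNIV :: 'a set)" "order_cone K" "closed K" "generating K"
    using assms by (auto simp: ordered_Banach_def)
  obtain r where r: "r > 0"
    and approx: "\<And>z t d. t > 0 \<Longrightarrow> d > 0 \<Longrightarrow> norm z < r * t \<Longrightarrow>
       \<exists>a\<in>K. \<exists>b\<in>K. norm a \<le> t \<and> norm b \<le> t \<and> norm (z - (a - b)) < d"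
    using generating_approx[OF B(1,2,4)] by blast
  show thesis
  proof
    show "r > 0" by (fact r)
    fix z :: 'a and t :: real
    assume t: "t > 0" and z: "norm z < r * t"
    \<comment> \<open>The clause for \<open>n = 0\<close> fixes the start of the chosen sequence of
      remainders at \<open>z\<close>.\<close>
    define P where "P n x \<longleftrightarrow> norm x < r * (t * (1/2)^n) \<and> (n = 0 \<longrightarrow> x = z)" for n and x :: 'a
    define Q where "Q n x x' \<longleftrightarrow> (\<exists>a\<in>K. \<exists>b\<in>K. norm a \<le> t * (1/2)^n \<and> norm b \<le> t * (1/2)^n \<and>
        x' = x - (a - b))" for n :: nat and x x' :: 'a
    have "\<exists>X. \<forall>n. P n (X n) \<and> Q n (X n) (X (Suc n))"
    proof (rule dependent_nat_choice)
      show "\<exists>x. P 0 x" using z by (simp add: P_def)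
      fix x n assume "P n x"
      then obtain a b where "a \<in> K" "b \<in> K" "norm a \<le> t * (1/2)^n" "norm b \<le> t * (1/2)^n"
        "norm (x - (a - b)) < r * (t * (1/2)^Suc n)"
        using approx[of "t * (1/2)^n" "r * (t * (1/2)^Suc n)" x] r t by (auto simp: P_def)
      then show "\<exists>x'. P (Suc n) x' \<and> Q n x x'"
        by (auto simp: P_def Q_def)
    qed
    then obtain X where X: "\<And>n. P n (X n)" "\<And>n. Q n (X n) (X (Suc n))" by blast
    then obtain a b where ab: "\<And>n. a n \<in> K" "\<And>n. b n \<in> K"
      "\<And>n. norm (a n) \<le> t * (1/2)^n" "\<And>n. norm (b n) \<le> t * (1/2)^n"
      "\<And>n. X (Suc n) = X n - (a n - b n)"
      unfolding Q_def by metis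
    obtain a' where a': "a sums a'" "a' \<in> K" "norm a' \<le> 2 * t"
      using cone_suminf_geometric[OF B(1-3) ab(1,3)] .
    obtain b' where b': "b sums b'" "b' \<in> K" "norm b' \<le> 2 * t"
      using cone_suminf_geometric[OF B(1-3) ab(2,4)] .
    have "X \<longlonglongrightarrow> 0"
    proof (rule Lim_null_comparison)
      show "\<forall>\<^sub>F n in sequentially. norm (X n) \<le> r * (t * (1/2)^n)"
        using X(1) by (auto simp: P_def intro!: always_eventually less_imp_le)
      show "(\<lambda>n. r * (t * (1/2)^n)) \<longlonglongrightarrow> 0"
        by (intro tendsto_mult_right_zero LIMSEQ_power_zero) simp
    qed
    \<comment> \<open>The differences of successive remainders are the terms
      \<open>a n - b n\<close>, so their series telescopes to \<open>z\<close>.\<close>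
    then have "(\<lambda>n. X n - X (Suc n)) sums (X 0 - 0)"
      by (rule telescope_sums')
    then have "(\<lambda>n. a n - b n) sums z"
      using X(1)[of 0] by (simp add: ab(5) P_def)
    then have "z = a' - b'"
      using sums_diff[OF a'(1) b'(1)] sums_unique2 by blast
    then show "\<exists>a\<in>K. \<exists>b\<in>K. norm a \<le> 2 * t \<and> norm b \<le> 2 * t \<and> z = a - b"
      using a' b' by blast
  qed
qed

lemma norm_order_dominated_Banach:
  fixes K :: "'a::real_normed_vector set"
  assumes "ordered_Banach K"
  shows "norm_order_dominated K"
  unfolding norm_order_dominated_def
proof (intro allI impI)
  fix e :: real assume e: "e > 0"
  have K: "order_cone K" using assms by (simp add: ordered_Banach_def)
  obtain r where r: "r > 0"
    and dec: "\<And>z t. t > 0 \<Longrightarrow> norm z < r * t \<Longrightarrow>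
       \<exists>a\<in>K. \<exists>b\<in>K. norm a \<le> 2 * t \<and> norm b \<le> 2 * t \<and> z = a - b"
    using ordered_Banach_decomposition[OF assms] by blast
  \<comment> \<open>With \<open>t = e/5\<close> the parts have norm at most
    \<open>2 * (e/5)\<close>, so \<open>w = a + b\<close> has norm at most \<open>4 * (e/5)\<close>,
    strictly below \<open>e\<close>.\<close>
  have "\<exists>w. norm w < e \<and> cone_le K (- w) z \<and> cone_le K z w" if "norm z < r * (e/5)" for z
  proof -
    from dec[OF _ that] e obtain a b where
      ab: "a \<in> K" "b \<in> K" "norm a \<le> 2 * (e/5)" "norm b \<le> 2 * (e/5)" "z = a - b"
      by auto
    have "norm (a + b) < e"
      using norm_triangle_ineq[of a b] ab(3,4) e by linarith
    moreover have "cone_le K (- (a + b)) z" "cone_le K z (a + b)"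
      using order_cone_add[OF K ab(1) ab(1)] order_cone_add[OF K ab(2) ab(2)]
      unfolding ab(5) by (simp_all add: cone_le_def)
    ultimately show ?thesis by blast
  qed
  then show "\<exists>d>0. \<forall>z. norm z < d \<longrightarrow> (\<exists>w. norm w < e \<and> cone_le K (- w) z \<and> cone_le K z w)"
    using r e by (intro exI[of _ "r * (e/5)"]) simp
qed

theorem lemma3p3:
  fixes K :: "'a::real_normed_vector set"
  assumes "(pre_Riesz K \<and> regular_norm K \<and> closed K) \<or>
           (ordered_Banach K \<and> semimonotone_norm K)"
  shows "\<forall>B. band K B \<longrightarrow> closed B"
proof -
  have "closed K" "order_cone K" "norm_order_dominated K"
    using assms norm_order_dominated_regular norm_order_dominated_Banach
    by (auto simp: pre_Riesz_def ordered_Banach_def)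
  then show ?thesis
    unfolding band_def by (metis closed_disj_compl)
qed

end
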